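(* Let $X$ be a locally convex Hausdorff real topological vector space, let $(A_i)_{i\in I}$ be a family of nonempty $w^*$-closed convex subsets of $X^*$, let $t_i\in\mathbb R$ for each $i\in I$, and let $f=\sum_{i\in I}^{R}(\sigma_{A_i}-t_i)$. Assume that $0_{X^*}\in\bigcap_{i\in I}A_i$, $\sup_{i\in I}t_i\le 0$, $f$ is proper, and the set $$\Big(\bigcup_{J\in\mathcal F(I)}\sum_{j\in J}\big[A_j\times\{t_j\}\big]\Big)+\{0_{X^*}\}\times\mathbb R_+$$ is $w^*$-closed regarding the set $\Big(\bigcup_{u\in X}\partial f(u)\Big)\times\mathbb R$. Then $$\partial f(x)=\bigcup_{J\in S_f(x)}\ \sum_{j\in J}\operatorname{argmax}_{A_j}\langle\cdot,x\rangle,\quad\forall x\in X.$$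
   Context: $X^*$ is the topological dual of $X$, equipped with the weak$^*$ topology ($X^*\times\mathbb R$ with the product topology), and $\langle x^*,x\rangle$ is the duality pairing. $I$ is an infinite index set and $\mathcal F(I)$ is the collection of all nonempty finite subsets of $I$. The robust sum of functions $f_i:X\to\mathbb R\cup\{+\infty\}$ is $\sum_{i\in I}^R f_i(x):=\sup_{J\in\mathcal F(I)}\sum_{i\in J}f_i(x)$. For $A\subset X^*$ nonempty, $\sigma_A(x)=\sup_{a^*\in A}\langle a^*,x\rangle$, and $\operatorname{argmax}_{A}\langle\cdot,x\rangle=\{x^*\in A:\langle x^*,x\rangle=\sigma_A(x)\}$. $\partial f(a)=\{x^*\in X^*: f(x)\ge f(a)+\langle x^*,x-a\rangle\ \forall x\in X\}$ if $f(a)\in\mathbb R$, and $\partial f(a)=\emptyset$ otherwise. For $x\in X$, $S_f(x)=\{J\in\mathcal F(I):\sum_{j\in J}(\sigma_{A_j}(x)-t_j)=f(x)\}$ if $f(x)<+\infty$, and $S_f(x)=\emptyset$ otherwise. A set $C$ is ($w^*$-)closed regarding a set $B$ if $B\cap\overline{C}=B\cap C$. Sums of sets are Minkowski sums. *)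

theory Defs
  imports "HOL-Analysis.Analysis"
begin

text \<open>Real Hausdorff locally convex spaces. The convexity of \<^term>\<open>V\<close> is spelled out because the
  constant \<^const>\<open>convex\<close> is not available inside the class specification.\<close>

class locally_convex_t2_space = real_vector + t2_space + topological_ab_group_add +
  assumes tendsto_scaleR_Pair:
      "((\<lambda>x. fst x *\<^sub>R snd x) \<longlongrightarrow> a *\<^sub>R b) (nhds a \<times>\<^sub>F nhds b)"
    and locally_convex:
      "eventually (\<lambda>x. x \<in> U) (nhds 0) \<Longrightarrow>
        \<exists>V\<subseteq>U. eventually (\<lambda>x. x \<in> V) (nhds 0) \<and>
          (\<forall>x\<in>V. \<forall>y\<in>V. \<forall>u\<ge>0. \<forall>v\<ge>0. u + v = 1 \<longrightarrow> u *\<^sub>R x + v *\<^sub>R y \<in> V)"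

instance real :: locally_convex_t2_space
proof
  fix a b :: real
  show "((\<lambda>x. fst x *\<^sub>R snd x) \<longlongrightarrow> a *\<^sub>R b) (nhds a \<times>\<^sub>F nhds b)"
    using tendsto_mult_Pair[of a b] by simp
next
  fix U :: "real set" assume "eventually (\<lambda>x. x \<in> U) (nhds 0)"
  then obtain e where e: "e > 0" "ball 0 e \<subseteq> U"
    by (force simp: eventually_nhds_metric)
  have "eventually (\<lambda>x. x \<in> ball 0 e) (nhds (0::real))"
    using e(1) by (intro eventually_nhds_in_open) auto
  moreover have "\<forall>x\<in>ball 0 e. \<forall>y\<in>ball 0 e. \<forall>u\<ge>0. \<forall>v\<ge>0. u + v = 1 \<longrightarrow> u *\<^sub>R x + v *\<^sub>R y \<in> ball (0::real) e"
    using convex_ball[of "0::real" e] unfolding convex_def by blast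
  ultimately show "\<exists>V\<subseteq>U. eventually (\<lambda>x. x \<in> V) (nhds 0) \<and>
      (\<forall>x\<in>V. \<forall>y\<in>V. \<forall>u\<ge>0. \<forall>v\<ge>0. u + v = 1 \<longrightarrow> u *\<^sub>R x + v *\<^sub>R y \<in> V)"
    using e(2) by blast
qed

typedef (overloaded) 'a dual =
  "{p :: 'a::{real_vector, topological_space} \<Rightarrow> real. linear p \<and> continuous_on UNIV p}"
  morphisms pairing Dual
  by (rule exI[of _ "\<lambda>_. 0"]) (simp add: linear_iff)

setup_lifting type_definition_dual

instantiation dual :: ("{real_vector, topological_space}") real_vector
begin

lift_definition zero_dual :: "'a dual" is "\<lambda>_. 0"
  by (simp add: linear_iff)

lift_definition plus_dual :: "'a dual \<Rightarrow> 'a dual \<Rightarrow> 'a dual" is "\<lambda>p q x. p x + q x"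
  by (auto simp: linear_iff algebra_simps intro: continuous_on_add)

lift_definition uminus_dual :: "'a dual \<Rightarrow> 'a dual" is "\<lambda>p x. - p x"
  by (auto simp: linear_iff algebra_simps intro: continuous_on_minus)

lift_definition minus_dual :: "'a dual \<Rightarrow> 'a dual \<Rightarrow> 'a dual" is "\<lambda>p q x. p x - q x"
  by (auto simp: linear_iff algebra_simps intro: continuous_on_diff)

lift_definition scaleR_dual :: "real \<Rightarrow> 'a dual \<Rightarrow> 'a dual" is "\<lambda>c p x. c * p x"
  by (auto simp: linear_iff algebra_simps intro: continuous_on_mult_left)

instance
  by standard (transfer; auto simp: fun_eq_iff algebra_simps)+

end

text \<open>The instance below equips the dual with the weak* topology: the coarsest topology making all
  evaluations continuous.\<close>

instantiation dual :: ("{real_vector, topological_space}") topological_space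
begin

definition open_dual :: "'a dual set \<Rightarrow> bool" where
  "open_dual = generate_topology {{p. pairing p x \<in> V} | x V. open V}"

instance
  by standard (auto simp: open_dual_def intro: generate_topology.intros)

end

text \<open>Functions into the reals extended by \<open>+\<infinity>\<close> are \<^typ>\<open>ereal\<close>-valued. \<^term>\<open>Fpow I - {{}}\<close> is the
  collection of nonempty finite subsets of \<^term>\<open>I\<close>. Sums of sets are Minkowski sums.\<close>

definition robust_sum :: "'i set \<Rightarrow> ('i \<Rightarrow> 'a \<Rightarrow> ereal) \<Rightarrow> 'a \<Rightarrow> ereal" where
  "robust_sum I g x = (SUP J \<in> Fpow I - {{}}. \<Sum>i\<in>J. g i x)"

definition support_fn :: "'a::{real_vector, topological_space} dual set \<Rightarrow> 'a \<Rightarrow> ereal" where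
  "support_fn A x = (SUP p \<in> A. ereal (pairing p x))"

definition argmax_on :: "'a::{real_vector, topological_space} dual set \<Rightarrow> 'a \<Rightarrow> 'a dual set" where
  "argmax_on A x = {p \<in> A. ereal (pairing p x) = support_fn A x}"

definition proper_fn :: "('a \<Rightarrow> ereal) \<Rightarrow> bool" where
  "proper_fn f \<longleftrightarrow> (\<forall>x. f x \<noteq> -\<infinity>) \<and> (\<exists>x. f x \<noteq> \<infinity>)"

definition subdifferential ::
    "('a::{real_vector, topological_space} \<Rightarrow> ereal) \<Rightarrow> 'a \<Rightarrow> 'a dual set" where
  "subdifferential f a =
    (if \<bar>f a\<bar> \<noteq> \<infinity> then {p. \<forall>x. f x \<ge> f a + ereal (pairing p (x - a))} else {})"

definition active_sets ::
    "'i set \<Rightarrow> ('i \<Rightarrow> 'a::{real_vector, topological_space} dual set) \<Rightarrow> ('i \<Rightarrow> real) \<Rightarrow>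
      ('a \<Rightarrow> ereal) \<Rightarrow> 'a \<Rightarrow> 'i set set" where
  "active_sets I A t f x =
    (if f x < \<infinity>
     then {J \<in> Fpow I - {{}}. (\<Sum>j\<in>J. support_fn (A j) x - ereal (t j)) = f x}
     else {})"

definition closed_regarding :: "'b::topological_space set \<Rightarrow> 'b set \<Rightarrow> bool" where
  "closed_regarding C B \<longleftrightarrow> B \<inter> closure C = B \<inter> C"

end

theory Submission
  imports Defs
begin

text \<open>Let \<open>C\<close> be the set whose relative closedness is assumed. Because \<open>0 \<in> A\<^sub>i\<close> and \<open>t\<^sub>i \<le> 0\<close>, the sets
  obtained from larger index sets \<open>J\<close> contain those from smaller ones, so \<open>C\<close> is convex; moreover
  \<open>f(x)\<close> is the supremum of \<open>\<langle>q,x\<rangle> - r\<close> over \<open>(q,r) \<in> C\<close>. If \<open>p \<in> \<partial>f(x)\<close>, then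
  \<open>(p, \<langle>p,x\<rangle> - f(x))\<close> lies in the closure of \<open>C\<close> by Hahn-Banach separation, hence in \<open>C\<close> by
  hypothesis. A representation of it as an element of \<open>C\<close> forces equality in
  \<open>\<Sum>(\<langle>a\<^sub>j,x\<rangle> - t\<^sub>j) \<le> \<Sum>(\<sigma>(x) - t\<^sub>j) \<le> f(x)\<close>, i.e. \<open>J\<close> is active and each \<open>a\<^sub>j\<close> is a maximiser.
  A weak* neighbourhood constrains finitely many coordinates, so the separation takes place in
  a finite-dimensional space, where the normal is the limit of a minimising sequence for the norm.\<close>

section \<open>Separation by finitely many linear functionals\<close>

text \<open>The squared norm \<open>N\<close> of the coordinate vector is at least
  \<open>e\<^sup>2\<close> on \<open>C\<close>. The vector \<open>c\<close> is the point nearest to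
  the origin in the closure of the image of \<open>C\<close>, and the hyperplane through it
  orthogonal to \<open>c\<close> leaves the image on the far side. Only coordinates are handled, so
  \<open>'v\<close> carries no topology.\<close>

lemma convex_separation_finite_functionals:
  fixes C :: "'v::real_vector set" and \<phi> :: "'k \<Rightarrow> 'v \<Rightarrow> real"
  assumes "finite S" and lin: "\<And>k. k \<in> S \<Longrightarrow> linear (\<phi> k)" and "convex C" and "e > 0"
    and far: "\<And>u. u \<in> C \<Longrightarrow> \<exists>k\<in>S. e \<le> \<bar>\<phi> k u\<bar>"
  obtains c \<delta> where "\<delta> > 0" "\<And>u. u \<in> C \<Longrightarrow> \<delta> \<le> (\<Sum>k\<in>S. c k * \<phi> k u)"
proof (cases "C = {}")
  case True
  then show ?thesis using that[of 1] by auto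
next
  case False
  define N where "N u = (\<Sum>k\<in>S. (\<phi> k u)\<^sup>2)" for u
  define d where "d = Inf (N ` C)"
  have Nge: "e\<^sup>2 \<le> N u" if u: "u \<in> C" for u
  proof -
    obtain k where k: "k \<in> S" "e \<le> \<bar>\<phi> k u\<bar>" using far[OF u] by blast
    have "e\<^sup>2 \<le> (\<phi> k u)\<^sup>2" using k(2) \<open>e > 0\<close> by (simp add: abs_le_square_iff[symmetric])
    also have "\<dots> \<le> N u" unfolding N_def
      using k(1) \<open>finite S\<close> by (intro member_le_sum) auto
    finally show ?thesis .
  qed
  have bdd: "bdd_below (N ` C)" using Nge by (rule bdd_belowI2)
  have dle: "d \<le> N u" if "u \<in> C" for u
    unfolding d_def using bdd that by (auto intro: cInf_lower)
  have "e\<^sup>2 \<le> d" unfolding d_def using False Nge by (auto intro: cInf_greatest)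
  then have "d > 0" using \<open>e > 0\<close> by (smt (verit) zero_less_power)
  have "\<exists>u\<in>C. N u < d + inverse (real (Suc n))" for n
    using cInf_lessD[of "N ` C" "d + inverse (real (Suc n))"] False unfolding d_def by auto
  then obtain z where z: "\<And>n. z n \<in> C" "\<And>n. N (z n) < d + inverse (real (Suc n))"
    by metis
  have comb: "\<phi> k (a *\<^sub>R u + b *\<^sub>R v) = a * \<phi> k u + b * \<phi> k v" if "k \<in> S" for k a b u v
    using lin[OF that] by (simp add: linear_add linear_scale)
  \<comment> \<open>Parallelogram identity: the midpoint of \<open>z m\<close> and
    \<open>z n\<close> stays in \<open>C\<close>, so its norm term is at least \<open>4 * d\<close>,
    and near-minimality of both ends makes their coordinates close.\<close>
  have close: "(\<phi> k (z m) - \<phi> k (z n))\<^sup>2 \<le> 2 * (inverse (Suc m) + inverse (Suc n))"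
    if k: "k \<in> S" for k m n
  proof -
    let ?w = "(1/2) *\<^sub>R z m + (1/2) *\<^sub>R z n"
    have "?w \<in> C" using \<open>convex C\<close> z(1) by (intro convexD) auto
    then have mid: "d \<le> N ?w" by (rule dle)
    have "(\<phi> k (z m) - \<phi> k (z n))\<^sup>2 \<le> (\<Sum>k\<in>S. (\<phi> k (z m) - \<phi> k (z n))\<^sup>2)"
      using k \<open>finite S\<close> by (intro member_le_sum) auto
    also have "\<dots> = (\<Sum>k\<in>S. 2 * (\<phi> k (z m))\<^sup>2 + 2 * (\<phi> k (z n))\<^sup>2 - 4 * (\<phi> k ?w)\<^sup>2)"
      by (intro sum.cong) (simp_all add: comb power2_eq_square field_simps)
    also have "\<dots> = 2 * N (z m) + 2 * N (z n) - 4 * N ?w"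
      unfolding N_def by (simp add: sum.distrib sum_subtractf sum_distrib_left)
    finally show ?thesis
      using mid z(2)[of m] z(2)[of n] unfolding distrib_left by (smt (verit))
  qed
  have "convergent (\<lambda>n. \<phi> k (z n))" if k: "k \<in> S" for k
    unfolding Cauchy_convergent_iff[symmetric]
  proof (rule metric_CauchyI)
    fix r :: real assume "r > 0"
    then obtain M where M: "inverse (real (Suc M)) < r\<^sup>2 / 4"
      using reals_Archimedean[of "r\<^sup>2 / 4"] by auto
    have "dist (\<phi> k (z m)) (\<phi> k (z n)) < r" if "m \<ge> M" "n \<ge> M" for m n
    proof -
      have "inverse (real (Suc m)) \<le> inverse (real (Suc M))"
           "inverse (real (Suc n)) \<le> inverse (real (Suc M))"
        using that by (auto intro!: le_imp_inverse_le)
      moreover have "y < r\<^sup>2" if "a \<le> c" "b \<le> c" "y \<le> 2 * (a + b)" "c < r\<^sup>2 / 4" for a b c y :: real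
        using that by argo
      ultimately have "(\<phi> k (z m) - \<phi> k (z n))\<^sup>2 < r\<^sup>2"
        using close[OF k] M by blast
      then show ?thesis
        using \<open>r > 0\<close> abs_le_square_iff[of r "\<phi> k (z m) - \<phi> k (z n)"]
        by (simp add: dist_real_def)
    qed
    then show "\<exists>M. \<forall>m\<ge>M. \<forall>n\<ge>M. dist (\<phi> k (z m)) (\<phi> k (z n)) < r" by blast
  qed
  then obtain c where c: "\<And>k. k \<in> S \<Longrightarrow> (\<lambda>n. \<phi> k (z n)) \<longlonglongrightarrow> c k"
    unfolding convergent_def by metis
  have cd: "(\<Sum>k\<in>S. (c k)\<^sup>2) \<le> d"
  proof (rule LIMSEQ_le)
    show "(\<lambda>n. N (z n)) \<longlonglongrightarrow> (\<Sum>k\<in>S. (c k)\<^sup>2)"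
      unfolding N_def by (intro tendsto_sum tendsto_power c)
    show "(\<lambda>n. d + inverse (real (Suc n))) \<longlonglongrightarrow> d"
      using tendsto_add[OF tendsto_const LIMSEQ_inverse_real_of_nat, of d] by simp
    show "\<exists>M. \<forall>n\<ge>M. N (z n) \<le> d + inverse (real (Suc n))"
      using z(2) less_imp_le by blast
  qed
  \<comment> \<open>The vector \<open>c\<close> need not be the image of a point of
    \<open>C\<close>; the bound holds on the segments from \<open>z n\<close> to \<open>y\<close>
    and survives the limit.\<close>
  have low: "d \<le> (\<Sum>k\<in>S. ((1 - l) * c k + l * \<phi> k y)\<^sup>2)" if y: "y \<in> C" and l: "0 \<le> l" "l \<le> 1" for y l
  proof (rule LIMSEQ_le_const)
    show "(\<lambda>n. \<Sum>k\<in>S. ((1 - l) * \<phi> k (z n) + l * \<phi> k y)\<^sup>2)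
        \<longlonglongrightarrow> (\<Sum>k\<in>S. ((1 - l) * c k + l * \<phi> k y)\<^sup>2)"
      by (intro tendsto_sum tendsto_power tendsto_add tendsto_mult c tendsto_const)
    have "d \<le> (\<Sum>k\<in>S. ((1 - l) * \<phi> k (z n) + l * \<phi> k y)\<^sup>2)" for n
    proof -
      have "(1 - l) *\<^sub>R z n + l *\<^sub>R y \<in> C"
        using \<open>convex C\<close> z(1) y l by (intro convexD) auto
      then have "d \<le> N ((1 - l) *\<^sub>R z n + l *\<^sub>R y)" by (rule dle)
      then show ?thesis unfolding N_def by (simp add: comb cong: sum.cong)
    qed
    then show "\<exists>M. \<forall>n\<ge>M. d \<le> (\<Sum>k\<in>S. ((1 - l) * \<phi> k (z n) + l * \<phi> k y)\<^sup>2)" by blast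
  qed
  have "d \<le> (\<Sum>k\<in>S. c k * \<phi> k y)" if y: "y \<in> C" for y
  proof -
    define a where "a = (\<Sum>k\<in>S. c k * (\<phi> k y - c k))"
    define b where "b = (\<Sum>k\<in>S. (\<phi> k y - c k)\<^sup>2)"
    have cc: "d \<le> (\<Sum>k\<in>S. (c k)\<^sup>2)" using low[OF y, of 0] by simp
    \<comment> \<open>First-order condition at the minimum: expand the square around
      \<open>c\<close>, drop the leading term by \<open>cd\<close>, and divide by
      \<open>l\<close>.\<close>
    have pos: "0 \<le> 2 * a + l * b" if l: "0 < l" "l \<le> 1" for l
    proof -
      have "(\<Sum>k\<in>S. ((1 - l) * c k + l * \<phi> k y)\<^sup>2)
          = (\<Sum>k\<in>S. (c k)\<^sup>2 + (2 * l) * (c k * (\<phi> k y - c k)) + l\<^sup>2 * (\<phi> k y - c k)\<^sup>2)"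
        by (intro sum.cong) (simp_all add: power2_eq_square algebra_simps)
      also have "\<dots> = (\<Sum>k\<in>S. (c k)\<^sup>2) + 2 * l * a + l\<^sup>2 * b"
        unfolding a_def b_def sum_distrib_left by (simp only: sum.distrib)
      finally have "0 \<le> l * (2 * a + l * b)"
        using low[OF y, of l] l cd by (simp add: power2_eq_square algebra_simps)
      then show ?thesis using l by (simp add: zero_le_mult_iff)
    qed
    have "b \<ge> 0" unfolding b_def by (intro sum_nonneg) auto
    have "a \<ge> 0"
    proof (rule ccontr)
      assume "\<not> a \<ge> 0"
      \<comment> \<open>Chosen so that \<open>l * b \<le> - a\<close>, whence
        \<open>2 * a + l * b \<le> a < 0\<close>. The summand 1 in the denominator covers
        \<open>b = 0\<close>.\<close>
      define l where "l = min 1 (- a / (b + 1))"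
      have l: "0 < l" "l \<le> 1" using \<open>\<not> a \<ge> 0\<close> \<open>b \<ge> 0\<close> by (auto simp: l_def field_simps)
      have "l * b \<le> (- a / (b + 1)) * b" using \<open>b \<ge> 0\<close> by (intro mult_right_mono) (auto simp: l_def)
      also have "\<dots> \<le> - a" using \<open>b \<ge> 0\<close> \<open>\<not> a \<ge> 0\<close> by (simp add: field_simps)
      finally show False using pos[OF l] \<open>\<not> a \<ge> 0\<close> by linarith
    qed
    moreover have "a = (\<Sum>k\<in>S. c k * \<phi> k y) - (\<Sum>k\<in>S. (c k)\<^sup>2)"
      unfolding a_def by (simp add: algebra_simps power2_eq_square sum_subtractf)
    ultimately show ?thesis using cc by linarith
  qed
  with \<open>d > 0\<close> show ?thesis by (rule that)
qed

section \<open>The dual pairing and weak* neighbourhoods\<close>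

lemma linear_pairing: "linear (pairing p)"
  using pairing[of p] by simp

lemma linear_pairing_left: "linear (\<lambda>p. pairing p x)"
  by (simp add: linear_iff plus_dual.rep_eq scaleR_dual.rep_eq)

lemma pairing_sum: "pairing (\<Sum>j\<in>J. a j) x = (\<Sum>j\<in>J. pairing (a j) x)"
  using linear_sum[OF linear_pairing_left, of a J] by simp

text \<open>Induction over the generated topology: an intersection is handled by uniting the two
  finite sets of test points and taking the smaller radius, so finiteness is never lost.\<close>

lemma weak_star_open_basis:
  assumes "open U" "p \<in> U"
  obtains F e where "finite F" "e > 0" "\<And>q. \<forall>x\<in>F. \<bar>pairing q x - pairing p x\<bar> < e \<Longrightarrow> q \<in> U"
proof -
  have "generate_topology {{p. pairing p x \<in> V} | x V. open V} U"
    using assms(1) by (simp add: open_dual_def)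
  then have "\<exists>F e. finite F \<and> e > 0 \<and> (\<forall>q. (\<forall>x\<in>F. \<bar>pairing q x - pairing p x\<bar> < e) \<longrightarrow> q \<in> U)"
    using \<open>p \<in> U\<close>
  proof (induction rule: generate_topology.induct)
    case UNIV
    show ?case by (auto intro!: exI[of _ "{}"] exI[of _ 1])
  next
    case (Int a b)
    then obtain F e G e' where *: "finite F" "e > 0" "finite G" "e' > 0"
      "\<forall>q. (\<forall>x\<in>F. \<bar>pairing q x - pairing p x\<bar> < e) \<longrightarrow> q \<in> a"
      "\<forall>q. (\<forall>x\<in>G. \<bar>pairing q x - pairing p x\<bar> < e') \<longrightarrow> q \<in> b" by auto
    show ?case
      by (rule exI[of _ "F \<union> G"], rule exI[of _ "min e e'"]) (use * in auto)
  next
    case (UN K)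
    then obtain k where k: "k \<in> K" "p \<in> k" by blast
    then obtain F e where "finite F" "e > 0"
      "\<forall>q. (\<forall>x\<in>F. \<bar>pairing q x - pairing p x\<bar> < e) \<longrightarrow> q \<in> k"
      using UN.IH[OF k] by blast
    then show ?case using k(1) by (intro exI[of _ F] exI[of _ e]) auto
  next
    case (Basis s)
    then obtain x V where s: "s = {p. pairing p x \<in> V}" "open V" by blast
    with Basis.prems obtain e where "e > 0" "ball (pairing p x) e \<subseteq> V"
      by (metis mem_Collect_eq openE)
    then show ?case unfolding s
      by (intro exI[of _ "{x}"] exI[of _ e]) (auto simp: dist_real_def subset_iff abs_minus_commute)
  qed
  then show ?thesis using that by blast
qed

text \<open>A product neighbourhood of \<open>(p, s)\<close> that misses \<open>C\<close> is
  controlled by finitely many evaluations and the real coordinate. The separating functional is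
  therefore a combination of these, and its dual part is evaluation at a single vector
  \<open>x\<close>. The sign of \<open>\<gamma>\<close> is left open.\<close>

lemma weak_star_separation:
  fixes C :: "('a::{real_vector, topological_space} dual \<times> real) set"
  assumes "convex C" and out: "(p, s) \<notin> closure C"
  shows "\<exists>x \<gamma>. \<exists>\<delta>>0. \<forall>q r. (q, r) \<in> C \<longrightarrow> pairing q x - pairing p x + \<delta> \<le> \<gamma> * (r - s)"
proof -
  have "open (- closure C)" by (rule open_Compl[OF closed_closure])
  then obtain U V where UV: "open U" "open V" "(p, s) \<in> U \<times> V" "U \<times> V \<subseteq> - closure C"
    using out by (metis open_prod_elim ComplI)
  obtain F e where F: "finite F" "e > 0"
      "\<And>q. \<forall>x\<in>F. \<bar>pairing q x - pairing p x\<bar> < e \<Longrightarrow> q \<in> U"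
    using weak_star_open_basis[OF UV(1), of p] UV(3) by auto
  obtain e' where e': "e' > 0" "ball s e' \<subseteq> V" using UV by (metis mem_Sigma_iff openE)
  \<comment> \<open>\<open>None\<close> indexes the real coordinate and \<open>Some x\<close> the
    evaluation at \<open>x\<close>.\<close>
  define \<phi> where "\<phi> k = (\<lambda>w::'a dual \<times> real. case k of None \<Rightarrow> snd w | Some x \<Rightarrow> pairing (fst w) x)" for k
  define S where "S = insert None (Some ` F)"
  define D where "D = (\<lambda>w. w - (p, s)) ` C"
  have fin: "finite S" using F by (simp add: S_def)
  have lin: "linear (\<phi> k)" for k
    by (cases k) (auto simp: \<phi>_def linear_iff plus_dual.rep_eq scaleR_dual.rep_eq)
  have conv: "convex D" using \<open>convex C\<close> unfolding D_def by (rule convex_translation_subtract)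
  have far: "\<exists>k\<in>S. min e e' \<le> \<bar>\<phi> k w\<bar>" if "w \<in> D" for w
  proof (rule ccontr)
    assume "\<not> ?thesis"
    then have small: "\<bar>\<phi> k w\<bar> < min e e'" if "k \<in> S" for k using that by (auto simp: not_le)
    obtain q r where qr: "(q, r) \<in> C" "w = (q - p, r - s)" using \<open>w \<in> D\<close> by (auto simp: D_def)
    have "q \<in> U"
    proof (rule F(3), rule ballI)
      fix x assume "x \<in> F"
      then show "\<bar>pairing q x - pairing p x\<bar> < e"
        using small[of "Some x"] by (simp add: S_def \<phi>_def qr(2) minus_dual.rep_eq)
    qed
    moreover have "r \<in> V"
      using e'(2) small[of None]
      by (auto simp: S_def \<phi>_def qr(2) dist_real_def subset_iff abs_minus_commute)
    ultimately show False using UV(4) qr(1) closure_subset[of C] by blast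
  qed
  obtain c \<delta> where c: "\<delta> > 0" "\<And>u. u \<in> D \<Longrightarrow> \<delta> \<le> (\<Sum>k\<in>S. c k * \<phi> k u)"
    using convex_separation_finite_functionals[OF fin lin conv _ far] F(2) e'(1)
    by (metis min_less_iff_conj)
  \<comment> \<open>The minus sign carries the evaluations to the other side of the inequality,
    where \<open>c None\<close> remains as \<open>\<gamma>\<close>.\<close>
  define x where "x = - (\<Sum>y\<in>F. c (Some y) *\<^sub>R y)"
  have px: "pairing q x = - (\<Sum>y\<in>F. c (Some y) * pairing q y)" for q
    unfolding x_def using linear_pairing[of q]
    by (simp add: linear_neg linear_sum linear_scale)
  show ?thesis
  proof (rule exI[of _ x], rule exI[of _ "c None"], rule exI[of _ \<delta>], intro conjI allI impI c(1))
    fix q r assume "(q, r) \<in> C"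
    then have "(q - p, r - s) \<in> D" by (force simp: D_def)
    from c(2)[OF this]
    have "\<delta> \<le> c None * (r - s) + (\<Sum>y\<in>F. c (Some y) * (pairing q y - pairing p y))"
      using F(1) by (simp add: S_def sum.reindex \<phi>_def minus_dual.rep_eq)
    then show "pairing q x - pairing p x + \<delta> \<le> c None * (r - s)"
      unfolding px by (simp add: right_diff_distrib sum_subtractf)
  qed
qed

section \<open>Finite sums of suprema and the robust sum\<close>

text \<open>The choices in different coordinates are independent: fix \<open>b\<close> in the new
  coordinate, apply the induction hypothesis with the bound \<open>M - g i b\<close>, then take the
  supremum over \<open>b\<close>.\<close>

lemma sum_SUP_ereal_le:
  fixes g :: "'i \<Rightarrow> 'b \<Rightarrow> real"
  assumes "finite J" and "\<And>j. j \<in> J \<Longrightarrow> B j \<noteq> {}"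
    and "\<And>a. (\<And>j. j \<in> J \<Longrightarrow> a j \<in> B j) \<Longrightarrow> (\<Sum>j\<in>J. g j (a j)) \<le> M"
  shows "(\<Sum>j\<in>J. SUP b\<in>B j. ereal (g j b)) \<le> ereal M"
  using assms
proof (induction J arbitrary: M rule: finite_induct)
  case empty
  then show ?case by simp
next
  case (insert i J)
  \<comment> \<open>A supremum commutes with adding a constant in \<open>ereal\<close> only when the
    case \<open>-\<infinity>\<close> is excluded.\<close>
  have ninf: "(\<Sum>j\<in>J. SUP b\<in>B j. ereal (g j b)) \<noteq> -\<infinity>"
  proof -
    have "\<forall>j\<in>J. \<exists>b. b \<in> B j" using insert.prems(1) by blast
    then obtain b where b: "\<And>j. j \<in> J \<Longrightarrow> b j \<in> B j" by metis
    have "ereal (\<Sum>j\<in>J. g j (b j)) = (\<Sum>j\<in>J. ereal (g j (b j)))" by simp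
    also have "\<dots> \<le> (\<Sum>j\<in>J. SUP b\<in>B j. ereal (g j b))"
      using b by (intro sum_mono SUP_upper)
    finally show ?thesis by auto
  qed
  have "ereal (g i b) + (\<Sum>j\<in>J. SUP b\<in>B j. ereal (g j b)) \<le> ereal M" if b: "b \<in> B i" for b
  proof -
    have "(\<Sum>j\<in>J. SUP b\<in>B j. ereal (g j b)) \<le> ereal (M - g i b)"
    proof (rule insert.IH)
      fix a assume a: "\<And>j. j \<in> J \<Longrightarrow> a j \<in> B j"
      have "(\<Sum>j\<in>insert i J. g j ((a(i := b)) j)) \<le> M"
        by (rule insert.prems(2)) (use a b in auto)
      moreover have "(\<Sum>j\<in>J. g j ((a(i := b)) j)) = (\<Sum>j\<in>J. g j (a j))"
        using insert.hyps by (intro sum.cong) auto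
      ultimately show "(\<Sum>j\<in>J. g j (a j)) \<le> M - g i b" using insert.hyps by simp
    qed (use insert.prems in auto)
    then have "ereal (g i b) + (\<Sum>j\<in>J. SUP b\<in>B j. ereal (g j b)) \<le> ereal (g i b) + ereal (M - g i b)"
      by (rule add_left_mono)
    then show ?thesis by simp
  qed
  then have "(SUP b\<in>B i. ereal (g i b) + (\<Sum>j\<in>J. SUP b\<in>B j. ereal (g j b))) \<le> ereal M"
    by (rule SUP_least)
  then show ?case
    using insert.hyps insert.prems(1)[of i] ninf by (simp add: SUP_ereal_add_left)
qed

lemma support_fn_minus:
  assumes "B \<noteq> {}"
  shows "support_fn B x - ereal s = (SUP b\<in>B. ereal (pairing b x - s))"
  unfolding support_fn_def using SUP_ereal_minus_left[OF assms, of "ereal s" "\<lambda>b. ereal (pairing b x)"] by simp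

text \<open>Bounds on the robust sum can thus be checked on finite real sums, one choice of
  functionals at a time.\<close>

lemma robust_sum_support_le:
  assumes "\<And>i. i \<in> I \<Longrightarrow> A i \<noteq> {}"
    and "\<And>J a. J \<in> Fpow I - {{}} \<Longrightarrow> (\<And>j. j \<in> J \<Longrightarrow> a j \<in> A j)
      \<Longrightarrow> (\<Sum>j\<in>J. pairing (a j) x - t j) \<le> M"
  shows "robust_sum I (\<lambda>i x. support_fn (A i) x - ereal (t i)) x \<le> ereal M"
  unfolding robust_sum_def
proof (rule SUP_least)
  fix J assume J: "J \<in> Fpow I - {{}}"
  then have fin: "finite J" and sub: "J \<subseteq> I" by (auto simp: Fpow_def)
  have "(\<Sum>j\<in>J. support_fn (A j) x - ereal (t j)) = (\<Sum>j\<in>J. SUP b\<in>A j. ereal (pairing b x - t j))"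
    using assms(1) sub by (intro sum.cong support_fn_minus) auto
  also have "\<dots> \<le> ereal M"
    using fin assms(1) sub assms(2)[OF J] by (intro sum_SUP_ereal_le) auto
  finally show "(\<Sum>j\<in>J. support_fn (A j) x - ereal (t j)) \<le> ereal M" .
qed

lemma sum_support_ge:
  assumes "\<And>j. j \<in> J \<Longrightarrow> a j \<in> A j"
  shows "ereal (\<Sum>j\<in>J. pairing (a j) x - t j) \<le> (\<Sum>j\<in>J. support_fn (A j) x - ereal (t j))"
proof -
  have "ereal (\<Sum>j\<in>J. pairing (a j) x - t j) = (\<Sum>j\<in>J. ereal (pairing (a j) x) - ereal (t j))"
    by simp
  also have "\<dots> \<le> (\<Sum>j\<in>J. support_fn (A j) x - ereal (t j))"
    using assms by (intro sum_mono ereal_minus_mono) (auto simp: support_fn_def intro: SUP_upper)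
  finally show ?thesis .
qed

section \<open>The set whose relative closedness is assumed\<close>

text \<open>A choice function \<open>a\<close> replaces the Minkowski sum, and the vertical ray
  turns equality in the second coordinate into an inequality.\<close>

lemma mem_sum_Times_singleton_iff:
  fixes A :: "'i \<Rightarrow> 'b::comm_monoid_add set" and t :: "'i \<Rightarrow> real"
  shows "(q, r) \<in> (\<Union>J \<in> Fpow I - {{}}. \<Sum>j\<in>J. A j \<times> {t j}) + {0} \<times> {0..} \<longleftrightarrow>
    (\<exists>J \<in> Fpow I - {{}}. \<exists>a. (\<forall>j\<in>J. a j \<in> A j) \<and> q = (\<Sum>j\<in>J. a j) \<and> (\<Sum>j\<in>J. t j) \<le> r)"
proof -
  have *: "(\<Sum>j\<in>J. A j \<times> {t j}) = {(\<Sum>j\<in>J. a j, \<Sum>j\<in>J. t j) | a. \<forall>j\<in>J. a j \<in> A j}"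
    if "J \<in> Fpow I - {{}}" for J
  proof -
    have "finite J" using that by (auto simp: Fpow_def)
    show ?thesis
      unfolding set_sum_alt[OF \<open>finite J\<close>]
    proof (intro Set.set_eqI iffI)
      fix w assume "w \<in> {sum s J | s. \<forall>i\<in>J. s i \<in> A i \<times> {t i}}"
      then obtain s where s: "w = sum s J" "\<forall>i\<in>J. s i \<in> A i \<times> {t i}" by blast
      have "sum s J = (\<Sum>j\<in>J. (fst (s j), t j))"
        using s(2) by (intro sum.cong) (auto simp: mem_Times_iff prod_eq_iff)
      then show "w \<in> {(sum a J, sum t J) | a. \<forall>j\<in>J. a j \<in> A j}"
        using s by (auto simp: sum_prod mem_Times_iff intro!: exI[of _ "\<lambda>j. fst (s j)"])
    next
      fix w assume "w \<in> {(sum a J, sum t J) | a. \<forall>j\<in>J. a j \<in> A j}"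
      then obtain a where "w = (sum a J, sum t J)" "\<forall>j\<in>J. a j \<in> A j" by blast
      then show "w \<in> {sum s J | s. \<forall>i\<in>J. s i \<in> A i \<times> {t i}}"
        by (intro CollectI exI[of _ "\<lambda>j. (a j, t j)"]) (simp add: sum_prod)
    qed
  qed
  show ?thesis
  proof
    assume "(q, r) \<in> (\<Union>J \<in> Fpow I - {{}}. \<Sum>j\<in>J. A j \<times> {t j}) + {0} \<times> {0..}"
    then obtain w v where w: "w \<in> (\<Union>J \<in> Fpow I - {{}}. \<Sum>j\<in>J. A j \<times> {t j})"
      and v: "v \<in> {0} \<times> {0..}" "(q, r) = w + v"
      by (rule set_plus_elim)
    from w obtain J where J: "J \<in> Fpow I - {{}}" "w \<in> (\<Sum>j\<in>J. A j \<times> {t j})" by blast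
    from J(2) obtain a where "w = (\<Sum>j\<in>J. a j, \<Sum>j\<in>J. t j)" "\<forall>j\<in>J. a j \<in> A j"
      unfolding *[OF J(1)] by blast
    then show "\<exists>J \<in> Fpow I - {{}}. \<exists>a. (\<forall>j\<in>J. a j \<in> A j) \<and> q = (\<Sum>j\<in>J. a j) \<and> (\<Sum>j\<in>J. t j) \<le> r"
      using J(1) v by (intro bexI[of _ J] exI[of _ a]) auto
  next
    assume "\<exists>J \<in> Fpow I - {{}}. \<exists>a. (\<forall>j\<in>J. a j \<in> A j) \<and> q = (\<Sum>j\<in>J. a j) \<and> (\<Sum>j\<in>J. t j) \<le> r"
    then obtain J a where J: "J \<in> Fpow I - {{}}" and a: "\<forall>j\<in>J. a j \<in> A j"
      "q = (\<Sum>j\<in>J. a j)" "(\<Sum>j\<in>J. t j) \<le> r" by blast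
    have "(\<Sum>j\<in>J. a j, \<Sum>j\<in>J. t j) \<in> (\<Sum>j\<in>J. A j \<times> {t j})"
      unfolding *[OF J] using a by blast
    then have "(\<Sum>j\<in>J. a j, \<Sum>j\<in>J. t j) \<in> (\<Union>J \<in> Fpow I - {{}}. \<Sum>j\<in>J. A j \<times> {t j})" using J by blast
    moreover have "(0, r - (\<Sum>j\<in>J. t j)) \<in> {0::'b} \<times> {0..}" using a by simp
    ultimately have "(\<Sum>j\<in>J. a j, \<Sum>j\<in>J. t j) + (0, r - (\<Sum>j\<in>J. t j))
        \<in> (\<Union>J \<in> Fpow I - {{}}. \<Sum>j\<in>J. A j \<times> {t j}) + {0} \<times> {0..}" by (rule set_plus_intro)
    then show "(q, r) \<in> (\<Union>J \<in> Fpow I - {{}}. \<Sum>j\<in>J. A j \<times> {t j}) + {0} \<times> {0..}"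
      using a by simp
  qed
qed

text \<open>Two points with index sets \<open>J\<close> and \<open>K\<close> are both rewritten over
  \<open>J \<union> K\<close>, padding with \<open>0\<close>. The additional \<open>t j\<close> are
  nonpositive, so the inequality in the second coordinate persists, and convexity of each
  \<open>A j\<close> applies coordinatewise.\<close>

lemma convex_Union_sum_Times_singleton:
  fixes A :: "'i \<Rightarrow> 'b::real_vector set" and t :: "'i \<Rightarrow> real"
  assumes A: "\<And>i. i \<in> I \<Longrightarrow> convex (A i)" and zero: "\<And>i. i \<in> I \<Longrightarrow> 0 \<in> A i"
    and t: "\<And>i. i \<in> I \<Longrightarrow> t i \<le> 0"
  shows "convex ((\<Union>J \<in> Fpow I - {{}}. \<Sum>j\<in>J. A j \<times> {t j}) + {0} \<times> {0..})" (is "convex ?C")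
proof (rule convexI)
  fix w w' :: "'b \<times> real" and u v :: real
  assume "w \<in> ?C" "w' \<in> ?C" and uv: "0 \<le> u" "0 \<le> v" "u + v = 1"
  obtain q r q' r' where w: "w = (q, r)" "w' = (q', r')" by (cases w, cases w')
  obtain J a where J: "J \<in> Fpow I - {{}}" "\<forall>j\<in>J. a j \<in> A j" "q = (\<Sum>j\<in>J. a j)" "(\<Sum>j\<in>J. t j) \<le> r"
    using \<open>w \<in> ?C\<close> unfolding w mem_sum_Times_singleton_iff by blast
  obtain K b where K: "K \<in> Fpow I - {{}}" "\<forall>j\<in>K. b j \<in> A j" "q' = (\<Sum>j\<in>K. b j)" "(\<Sum>j\<in>K. t j) \<le> r'"
    using \<open>w' \<in> ?C\<close> unfolding w mem_sum_Times_singleton_iff by blast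
  define L where "L = J \<union> K"
  have fin: "finite L" and LI: "L \<subseteq> I" using J(1) K(1) by (auto simp: L_def Fpow_def)
  have L: "L \<in> Fpow I - {{}}" using J(1) K(1) by (auto simp: L_def Fpow_def)
  define a' where "a' j = (if j \<in> J then a j else 0)" for j
  define b' where "b' j = (if j \<in> K then b j else 0)" for j
  have mem: "a' j \<in> A j" "b' j \<in> A j" if "j \<in> L" for j
    using that LI J(2) K(2) zero by (auto simp: a'_def b'_def)
  have q: "q = (\<Sum>j\<in>L. a' j)" unfolding J(3) a'_def L_def
    using fin by (intro sum.mono_neutral_cong_left) (auto simp: L_def)
  have q': "q' = (\<Sum>j\<in>L. b' j)" unfolding K(3) b'_def L_def
    using fin by (intro sum.mono_neutral_cong_left) (auto simp: L_def)
  have mono: "(\<Sum>j\<in>L. t j) \<le> (\<Sum>j\<in>M. t j)" if "M \<subseteq> L" for M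
    using sum_mono2[OF fin that, of "\<lambda>j. - t j"] t LI by (auto simp: sum_negf)
  have "(\<Sum>j\<in>L. t j) \<le> r" "(\<Sum>j\<in>L. t j) \<le> r'"
    using mono[of J] mono[of K] J(4) K(4) by (auto simp: L_def)
  then have "u * (\<Sum>j\<in>L. t j) + v * (\<Sum>j\<in>L. t j) \<le> u * r + v * r'"
    using uv by (intro add_mono mult_left_mono)
  then have "(\<Sum>j\<in>L. t j) \<le> u * r + v * r'" using uv by (simp flip: distrib_right)
  moreover have "u *\<^sub>R q + v *\<^sub>R q' = (\<Sum>j\<in>L. u *\<^sub>R a' j + v *\<^sub>R b' j)"
    unfolding q q' by (simp add: scaleR_sum_right sum.distrib)
  moreover have "u *\<^sub>R a' j + v *\<^sub>R b' j \<in> A j" if "j \<in> L" for j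
    using A mem[OF that] that LI uv by (intro convexD) auto
  ultimately have "(u *\<^sub>R q + v *\<^sub>R q', u * r + v * r') \<in> ?C"
    unfolding mem_sum_Times_singleton_iff using L
    by (intro bexI[of _ L] exI[of _ "\<lambda>j. u *\<^sub>R a' j + v *\<^sub>R b' j"]) auto
  then show "u *\<^sub>R w + v *\<^sub>R w' \<in> ?C" unfolding w by simp
qed

section \<open>The subdifferential of the robust sum of support functions\<close>

theorem proposition5p4:
  fixes I :: "'i set"
    and A :: "'i \<Rightarrow> 'a::locally_convex_t2_space dual set"
    and t :: "'i \<Rightarrow> real"
    and f :: "'a \<Rightarrow> ereal"
  assumes "infinite I"
    and "\<And>i. i \<in> I \<Longrightarrow> A i \<noteq> {}"
    and "\<And>i. i \<in> I \<Longrightarrow> closed (A i)"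
    and "\<And>i. i \<in> I \<Longrightarrow> convex (A i)"
    and "f = robust_sum I (\<lambda>i x. support_fn (A i) x - ereal (t i))"
    and "0 \<in> (\<Inter>i\<in>I. A i)"
    and "(SUP i\<in>I. ereal (t i)) \<le> 0"
    and "proper_fn f"
    and "closed_regarding
           ((\<Union>J \<in> Fpow I - {{}}. \<Sum>j\<in>J. A j \<times> {t j}) + {0} \<times> {0..})
           ((\<Union>u. subdifferential f u) \<times> UNIV)"
  shows "\<forall>x. subdifferential f x =
           (\<Union>J \<in> active_sets I A t f x. \<Sum>j\<in>J. argmax_on (A j) x)"
proof -
  define C where "C = (\<Union>J \<in> Fpow I - {{}}. \<Sum>j\<in>J. A j \<times> {t j}) + {0} \<times> {0::real..}"
  have tneg: "t i \<le> 0" if "i \<in> I" for i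
    using assms(7) that by (simp add: SUP_le_iff zero_ereal_def)
  have convC: "convex C" unfolding C_def
    using assms(4,6) tneg by (intro convex_Union_sum_Times_singleton) auto
  have memC: "(q, r) \<in> C \<longleftrightarrow>
    (\<exists>J \<in> Fpow I - {{}}. \<exists>a. (\<forall>j\<in>J. a j \<in> A j) \<and> q = (\<Sum>j\<in>J. a j) \<and> (\<Sum>j\<in>J. t j) \<le> r)" for q r
    unfolding C_def by (rule mem_sum_Times_singleton_iff)
  have fge: "(\<Sum>j\<in>J. support_fn (A j) x - ereal (t j)) \<le> f x" if "J \<in> Fpow I - {{}}" for J x
    unfolding assms(5) robust_sum_def using that by (rule SUP_upper)
  have fge': "ereal (\<Sum>j\<in>J. pairing (a j) x - t j) \<le> f x"
    if "J \<in> Fpow I - {{}}" "\<forall>j\<in>J. a j \<in> A j" for J a x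
    using sum_support_ge[of J a A x t] fge[OF that(1), of x] that(2) by (auto intro: order_trans)
  \<comment> \<open>Together with \<open>fleC\<close> this identifies \<open>f x\<close> as the
    support function of \<open>C\<close> in the direction \<open>(x, -1)\<close>.\<close>
  have fgeC: "ereal (pairing q x - r) \<le> f x" if qr: "(q, r) \<in> C" for q r x
  proof -
    obtain J a where J: "J \<in> Fpow I - {{}}" "\<forall>j\<in>J. a j \<in> A j"
      and q: "q = (\<Sum>j\<in>J. a j)" and r: "(\<Sum>j\<in>J. t j) \<le> r"
      using qr unfolding memC by blast
    have "pairing q x - r \<le> (\<Sum>j\<in>J. pairing (a j) x - t j)"
      using r by (simp add: q pairing_sum sum_subtractf)
    then show ?thesis using fge'[OF J, of x] order_trans ereal_less_eq(3) by blast
  qed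
  have fleC: "f x \<le> ereal M" if M: "\<And>q r. (q, r) \<in> C \<Longrightarrow> pairing q x - r \<le> M" for x M
    unfolding assms(5)
  proof (rule robust_sum_support_le[OF assms(2)])
    fix J a assume "J \<in> Fpow I - {{}}" "\<And>j. j \<in> J \<Longrightarrow> a j \<in> A j"
    then have "(\<Sum>j\<in>J. a j, \<Sum>j\<in>J. t j) \<in> C" unfolding memC by blast
    from M[OF this] show "(\<Sum>j\<in>J. pairing (a j) x - t j) \<le> M"
      by (simp add: pairing_sum sum_subtractf)
  qed
  have upC: "(q, r') \<in> C" if "(q, r) \<in> C" "r \<le> r'" for q r r'
    using that unfolding memC by (meson order_trans)
  have neC: "\<exists>q r. (q, r) \<in> C"
  proof -
    obtain i where "i \<in> I" using assms(1) by fastforce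
    then have "{i} \<in> Fpow I - {{}}" "\<forall>j\<in>{i}. 0 \<in> A j" using assms(6) by (auto simp: Fpow_def)
    then have "(\<Sum>j\<in>{i}. 0, \<Sum>j\<in>{i}. t j) \<in> C"
      unfolding memC by (intro bexI[of _ "{i}"] exI[of _ "\<lambda>_. 0"]) auto
    then show ?thesis by blast
  qed

  \<comment> \<open>Otherwise separation yields a point \<open>y\<close> at which \<open>f\<close>
    falls strictly below the affine function of slope \<open>p\<close> that touches \<open>f\<close>
    at \<open>x\<close>.\<close>
  have closure: "(p, pairing p x - c) \<in> closure C"
    if p: "p \<in> subdifferential f x" and c: "f x = ereal c" for p x c
  proof (rule ccontr)
    define s where "s = pairing p x - c"
    assume "(p, pairing p x - c) \<notin> closure C"
    then have out: "(p, s) \<notin> closure C" by (simp add: s_def)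
    obtain z \<gamma> \<delta> where d: "\<delta> > 0"
      and sep: "\<And>q r. (q, r) \<in> C \<Longrightarrow> pairing q z - pairing p z + \<delta> \<le> \<gamma> * (r - s)"
      using weak_star_separation[OF convC out] by blast
    \<comment> \<open>\<open>C\<close> is closed upwards in \<open>r\<close>, so a negative
      \<open>\<gamma>\<close> would push the right side of \<open>sep\<close> below any bound;
      raising \<open>r\<close> by \<open>k\<close> suffices.\<close>
    have "\<gamma> \<ge> 0"
    proof (rule ccontr)
      assume neg: "\<not> \<gamma> \<ge> 0"
      obtain q r where qr: "(q, r) \<in> C" using neC by blast
      define m where "m = \<gamma> * (r - s) - (pairing q z - pairing p z)"
      define k where "k = max 0 (m / (- \<gamma>))"
      have "(q, r + k) \<in> C" using upC[OF qr] by (simp add: k_def)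
      from sep[OF this] have "\<delta> \<le> m + \<gamma> * k" by (simp add: m_def algebra_simps)
      moreover have "0 < - \<gamma>" using neg by simp
      then have "m \<le> k * (- \<gamma>)" by (subst pos_divide_le_eq[symmetric]) (simp_all add: k_def)
      ultimately show False using d by (simp add: mult.commute)
    qed
    \<comment> \<open>Adding the bound at \<open>x\<close> makes the coefficient of \<open>r - s\<close> positive even if \<open>\<gamma> = 0\<close>, which
      avoids a separate treatment of vertical hyperplanes.\<close>
    define y where "y = inverse (1 + \<gamma>) *\<^sub>R (x + z)"
    have py: "pairing q y = (pairing q x + pairing q z) / (1 + \<gamma>)" for q
      unfolding y_def using linear_pairing[of q]
      by (simp add: linear_scale linear_add divide_inverse mult.commute)
    \<comment> \<open>Add the bound at \<open>x\<close> to \<open>sep\<close> and divide by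
      \<open>1 + \<gamma>\<close>; the gap \<open>\<delta>\<close> survives as
      \<open>\<delta> / (1 + \<gamma>)\<close>, while the subgradient inequality gives
      \<open>f y \<ge> pairing p y - s\<close>.\<close>
    have "f y \<le> ereal (pairing p y - s - \<delta> / (1 + \<gamma>))"
    proof (rule fleC)
      fix q r assume qr: "(q, r) \<in> C"
      have "pairing q x - r \<le> pairing p x - s"
        using fgeC[OF qr, of x] c by (simp add: s_def)
      then have "pairing q x + pairing q z \<le> pairing p x + pairing p z + (1 + \<gamma>) * (r - s) - \<delta>"
        using sep[OF qr] by (simp add: algebra_simps)
      then have "pairing q y \<le> (pairing p x + pairing p z + (1 + \<gamma>) * (r - s) - \<delta>) / (1 + \<gamma>)"
        unfolding py using \<open>\<gamma> \<ge> 0\<close> by (intro divide_right_mono) auto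
      also have "\<dots> = pairing p y + (r - s) - \<delta> / (1 + \<gamma>)"
        unfolding py using \<open>\<gamma> \<ge> 0\<close> by (simp add: add_divide_distrib diff_divide_distrib)
      finally show "pairing q y - r \<le> pairing p y - s - \<delta> / (1 + \<gamma>)" by simp
    qed
    moreover have "f x + ereal (pairing p (y - x)) \<le> f y"
      using p by (auto simp: subdifferential_def split: if_splits)
    ultimately have "ereal (c + pairing p (y - x)) \<le> ereal (pairing p y - s - \<delta> / (1 + \<gamma>))"
      using c by (metis order_trans plus_ereal.simps(1))
    then have "\<delta> / (1 + \<gamma>) \<le> 0"
      using linear_diff[OF linear_pairing, of p y x] by (simp add: s_def)
    then show False using d \<open>\<gamma> \<ge> 0\<close> by (simp add: divide_le_0_iff)
  qed

  show ?thesis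
  proof (intro allI Set.set_eqI iffI)
    fix x p assume p: "p \<in> subdifferential f x"
    then obtain c where c: "f x = ereal c"
      by (auto simp: subdifferential_def split: if_splits)
    have "(p, pairing p x - c) \<in> ((\<Union>u. subdifferential f u) \<times> UNIV) \<inter> closure C"
      using closure[OF p c] p by blast
    then have "(p, pairing p x - c) \<in> C"
      using assms(9) unfolding closed_regarding_def C_def by blast
    then obtain J a where J: "J \<in> Fpow I - {{}}" "\<forall>j\<in>J. a j \<in> A j"
      and pa: "p = (\<Sum>j\<in>J. a j)" and r: "(\<Sum>j\<in>J. t j) \<le> pairing p x - c"
      unfolding memC by blast
    have fin: "finite J" and sub: "J \<subseteq> I" using J(1) by (auto simp: Fpow_def)
    have "c \<le> (\<Sum>j\<in>J. pairing (a j) x - t j)"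
      using r by (simp add: pa pairing_sum sum_subtractf)
    then have le: "f x \<le> ereal (\<Sum>j\<in>J. pairing (a j) x - t j)" using c by simp
    have act: "(\<Sum>j\<in>J. support_fn (A j) x - ereal (t j)) = f x"
      using le sum_support_ge[of J a A x t] J(2) fge[OF J(1), of x] by (auto intro: antisym)
    have ge: "ereal (pairing (a j) x) \<le> support_fn (A j) x" if "j \<in> J" for j
      unfolding support_fn_def using J(2) that by (intro SUP_upper) auto
    have "a j \<in> argmax_on (A j) x" if j: "j \<in> J" for j
    proof -
      have "support_fn (A j) x \<le> ereal (pairing (a j) x)"
        unfolding support_fn_def
      proof (rule SUP_least)
        fix b assume b: "b \<in> A j"
        \<comment> \<open>Exchange argument: changing only coordinate \<open>j\<close> cannot beat
          the total for \<open>a\<close>, which already reaches \<open>f x\<close>. Comparing real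
          sums allows the other terms to be cancelled.\<close>
        have "ereal (\<Sum>i\<in>J. pairing ((a(j := b)) i) x - t i) \<le> f x"
          using J b by (intro fge') auto
        also note le
        finally have "(\<Sum>i\<in>J. pairing ((a(j := b)) i) x - t i) \<le> (\<Sum>i\<in>J. pairing (a i) x - t i)"
          by simp
        moreover have "(\<Sum>i\<in>J - {j}. pairing ((a(j := b)) i) x - t i) = (\<Sum>i\<in>J - {j}. pairing (a i) x - t i)"
          by (intro sum.cong) auto
        ultimately show "ereal (pairing b x) \<le> ereal (pairing (a j) x)"
          by (simp add: sum.remove[OF fin j])
      qed
      with ge[OF j] have "ereal (pairing (a j) x) = support_fn (A j) x" by (rule antisym)
      then show ?thesis using J(2) j by (simp add: argmax_on_def)
    qed
    then have "p \<in> (\<Sum>j\<in>J. argmax_on (A j) x)"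
      unfolding pa set_sum_alt[OF fin] by blast
    moreover have "J \<in> active_sets I A t f x"
      using J act c by (simp add: active_sets_def)
    ultimately show "p \<in> (\<Union>J \<in> active_sets I A t f x. \<Sum>j\<in>J. argmax_on (A j) x)" by blast
  next
    fix x p assume "p \<in> (\<Union>J \<in> active_sets I A t f x. \<Sum>j\<in>J. argmax_on (A j) x)"
    then obtain J where J: "J \<in> Fpow I - {{}}"
      and act: "(\<Sum>j\<in>J. support_fn (A j) x - ereal (t j)) = f x"
      and pJ: "p \<in> (\<Sum>j\<in>J. argmax_on (A j) x)"
      by (auto simp: active_sets_def split: if_splits)
    have fin: "finite J" using J by (auto simp: Fpow_def)
    obtain a where pa: "p = (\<Sum>j\<in>J. a j)" and a: "\<forall>j\<in>J. a j \<in> argmax_on (A j) x"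
      using pJ unfolding set_sum_alt[OF fin] by blast
    have aA: "\<forall>j\<in>J. a j \<in> A j" using a by (simp add: argmax_on_def)
    \<comment> \<open>Attained suprema are finite, so \<open>f x\<close> is real. The affine
      function of slope \<open>p\<close> given by \<open>a\<close> and \<open>t\<close> is then
      exact at \<open>x\<close>, and \<open>fge'\<close> makes it a minorant of
      \<open>f\<close>.\<close>
    have "(\<Sum>j\<in>J. support_fn (A j) x - ereal (t j)) = (\<Sum>j\<in>J. ereal (pairing (a j) x - t j))"
      using a by (intro sum.cong) (auto simp: argmax_on_def simp flip: ereal_minus(1))
    then have fx: "f x = ereal (pairing p x - (\<Sum>j\<in>J. t j))"
      unfolding act by (simp add: pa pairing_sum sum_subtractf)
    have "f x + ereal (pairing p (y - x)) \<le> f y" for y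
    proof -
      have "f x + ereal (pairing p (y - x)) = ereal (\<Sum>j\<in>J. pairing (a j) y - t j)"
        unfolding fx using linear_diff[OF linear_pairing, of p y x]
        by (simp add: pa pairing_sum sum_subtractf)
      then show ?thesis using fge'[OF J aA, of y] by simp
    qed
    then show "p \<in> subdifferential f x" using fx by (simp add: subdifferential_def)
  qed
qed

end
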